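(* Let $G_1,\dots,G_m$ be cumulative distribution functions (not necessarily discrete) and let $H_{G_1,\dots,G_m}$ be a cumulative distribution function generated from $G_1,\dots,G_m$ by Form A (respectively, by Form B), as defined in the context. Suppose that $F$ (respectively, $\varphi$) is discrete and that $\mathcal U(.)(x)=\vartheta(.)(x)=1$ for all $x\in\mathbb{R}$. Then $H_{G_1,\dots,G_m}$ is discrete, whatever the monotonic functions $\mu_j,\ell_j,\nu_j,m_j$ used as limits of integration.
   Context: A cumulative distribution function (cdf) is a non-decreasing right continuous $F:\mathbb{R}\to\mathbb{R}$ with limits $0$ at $-\infty$ and $1$ at $+\infty$. The support of a cdf $F$ is $S_F=\{x\in\mathbb{R}:F(x)-F(x-\varepsilon)>0\ \ \forall\varepsilon>0\}$. A cdf $F$ is called discrete if $S_F$ is countable. Conventions: $F(-\infty)=0$, $F(+\infty)=1$, $\int_a^b dF=F(b)-F(a)$ for $a,b\in\mathbb{R}\cup\{\pm\infty\}$; sup, inf and continuity for extended-real-valued functions are in $\mathbb{R}\cup\{\pm\infty\}$. A function $h$ on $[0,1]^m$ is right continuous if $h(s)\to h(t)$ as $s\to t$ with $s_i\ge t_i$ for all $i$. For cdfs $G_1,\dots,G_m$ ($m\ge1$) write $h(.)(x)=h(G_1(x),\dots,G_m(x))$, $\mathbf0=(0,\dots,0)$, $\mathbf1=(1,\dots,1)$. Say $f:\mathbb{R}\to\mathbb{R}\cup\{\pm\infty\}$ is compatible with a cdf $F$ if for every $x_0$ such that $f(x_0)$ is a discontinuity point of $F$, $f$ is continuous at $x_0$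 and constant on some $[x_0,x_0+\delta)$, $\delta>0$. **Form A.** Data: $n\ge1$; $F:\mathbb{R}\to\mathbb{R}$; monotonic right continuous $\mathcal U,\vartheta:[0,1]^m\to\mathbb{R}$ and $\mu_j,\ell_j,\nu_j,m_j:[0,1]^m\to\mathbb{R}\cup\{\pm\infty\}$, $1\le j\le n$, with: (1) $F$ a cdf, $\mathcal U,\vartheta\ge0$; (2) $\mu_j,m_j,\mathcal U$ non-decreasing, $\ell_j,\nu_j,\vartheta$ non-increasing in all variables; (3) if $\mathcal U(\mathbf0)\ne\vartheta(\mathbf0)$, then [$\mathcal U(\mathbf0)=0$ or $\mu_j(\mathbf0)=\ell_j(\mathbf0)\ \forall j$] and [$\vartheta(\mathbf0)=0$ or $m_j(\mathbf0)=\nu_j(\mathbf0)\ \forall j$]; (4) if $\mathcal U(\mathbf0)=\vartheta(\mathbf0)\ne0$, then $\mu_j(\mathbf0)=\nu_j(\mathbf0)$ and $m_j(\mathbf0)=\ell_j(\mathbf0)\ \forall j$; (5) $\ell_j(\mathbf0)\le\mu_j(\mathbf0)\ \forall j$, and if $\vartheta(\mathbf0)\ne0$ then $m_j(\mathbf1)\le\nu_j(\mathbf1)\ \forall j$; (6) $\mu_n(\mathbf1)\ge\sup\{x:F(x)<1\}$ and $\ell_1(\mathbf1)\le\inf\{x:F(x)>0\}$; (7) $\mathcal U(\mathbf1)=1$; (8) $\vartheta(\mathbf1)=0$ or $\nu_j(\mathbf1)=m_j(\mathbf1)\ \forall j$; (9) $\mu_j(\mathbf1)=\ell_{j+1}(\mathbf1)$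 for $1\le j\le n-1$; (10) $F$ is continuous or all functions $x\mapsto\ell_j(.)(x)$, $x\mapsto\nu_j(.)(x)$ are compatible with $F$; moreover $F$ has no discontinuity at any of the values of $\ell_j,\mu_j,m_j,\nu_j$ at $\mathbf0$ and $\mathbf1$. The generated function is $$H_{G_1,\dots,G_m}(x)=\mathcal U(.)(x)\sum_{j=1}^n\int_{\ell_j(.)(x)}^{\mu_j(.)(x)}dF(t)-\vartheta(.)(x)\sum_{j=1}^n\int_{m_j(.)(x)}^{\nu_j(.)(x)}dF(t).$$ **Form B.** Data: $\eta\ge1$; $\varphi:\mathbb{R}\to\mathbb{R}$; monotonic right continuous $\mathcal U,\vartheta:[0,1]^m\to\mathbb{R}$ and $\mu_j,\ell_j,\nu_j,m_j:[0,1]^m\to\mathbb{R}\cup\{\pm\infty\}$, $1\le j\le\eta$, with: (1) $\varphi$ a cdf, $\mathcal U,\vartheta\ge0$; (2) $\mu_j,m_j,\mathcal U$ non-decreasing, $\ell_j,\nu_j,\vartheta$ non-increasing in all variables; (3) if $\mathcal U(\mathbf1)\ne\vartheta(\mathbf1)$, then [$\vartheta(\mathbf1)=0$ or $m_j(\mathbf1)=\nu_j(\mathbf1)\ \forall j$] and [$\mathcal U(\mathbf1)=0$ or $\ell_j(\mathbf1)=\mu_j(\mathbf1)\ \forall j$]; (4) if $\mathcal U(\mathbf1)=\vartheta(\mathbf1)\ne0$, then $\mu_j(\mathbf1)=\nu_j(\mathbf1)$ and $m_j(\mathbf1)=\ell_j(\mathbf1)\ \forall j$; (5) $m_j(\mathbf1)\le\nu_j(\mathbf1)\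 \forall j$, and if $\mathcal U(\mathbf1)\ne0$ then $\ell_j(\mathbf0)\le\mu_j(\mathbf0)\ \forall j$; (6) $\nu_\eta(\mathbf0)\ge\sup\{x:\varphi(x)<1\}$ and $m_1(\mathbf0)\le\inf\{x:\varphi(x)>0\}$; (7) $\vartheta(\mathbf0)=1$; (8) $\mathcal U(\mathbf0)=0$ or $\ell_j(\mathbf0)=\mu_j(\mathbf0)\ \forall j$; (9) $\nu_j(\mathbf0)=m_{j+1}(\mathbf0)$ for $1\le j\le\eta-1$; (10) $\varphi$ is continuous or all functions $x\mapsto\ell_j(.)(x)$, $x\mapsto\nu_j(.)(x)$ are compatible with $\varphi$; moreover $\varphi$ has no discontinuity at any of the values of $\ell_j,\mu_j,m_j,\nu_j$ at $\mathbf0$ and $\mathbf1$. The generated function is $$H_{G_1,\dots,G_m}(x)=1-\vartheta(.)(x)\sum_{j=1}^\eta\int_{m_j(.)(x)}^{\nu_j(.)(x)}d\varphi(t)+\mathcal U(.)(x)\sum_{j=1}^\eta\int_{\ell_j(.)(x)}^{\mu_j(.)(x)}d\varphi(t).$$ *)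

theory Defs
  imports "HOL-Analysis.Analysis"
begin

section \<open>Cumulative distribution functions\<close>

definition is_cdf :: "(real \<Rightarrow> real) \<Rightarrow> bool" where
  "is_cdf F \<longleftrightarrow> mono F \<and> (\<forall>x. continuous (at_right x) F) \<and>
     (F \<longlongrightarrow> 0) at_bot \<and> (F \<longlongrightarrow> 1) at_top"

definition cdf_support :: "(real \<Rightarrow> real) \<Rightarrow> real set" where
  "cdf_support F = {x. \<forall>\<epsilon>>0. F x - F (x - \<epsilon>) > 0}"

definition discrete_cdf :: "(real \<Rightarrow> real) \<Rightarrow> bool" where
  "discrete_cdf F \<longleftrightarrow> is_cdf F \<and> countable (cdf_support F)"

definition cdf_ext :: "(real \<Rightarrow> real) \<Rightarrow> ereal \<Rightarrow> real" where
  "cdf_ext F y = (case y of ereal x \<Rightarrow> F x | PInfty \<Rightarrow> 1 | MInfty \<Rightarrow> 0)"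

text \<open>The increment over \<open>a\<close>, \<open>b\<close> is signed: no assumption \<open>a \<le> b\<close> is made.\<close>

definition cdf_integral :: "(real \<Rightarrow> real) \<Rightarrow> ereal \<Rightarrow> ereal \<Rightarrow> real" where
  "cdf_integral F a b = cdf_ext F b - cdf_ext F a"

text \<open>
  Infinite values are never discontinuity points: the extension of a cdf by
  \<open>0\<close> at \<open>-\<infinity>\<close> and \<open>1\<close> at \<open>\<infinity>\<close> is continuous there.
\<close>

definition discontinuity_point :: "(real \<Rightarrow> real) \<Rightarrow> ereal \<Rightarrow> bool" where
  "discontinuity_point F y \<longleftrightarrow> (\<exists>x. y = ereal x \<and> \<not> isCont F x)"

definition compatible :: "(real \<Rightarrow> real) \<Rightarrow> (real \<Rightarrow> ereal) \<Rightarrow> bool" where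
  "compatible F f \<longleftrightarrow> (\<forall>x\<^sub>0. discontinuity_point F (f x\<^sub>0) \<longrightarrow>
     isCont f x\<^sub>0 \<and> (\<exists>\<delta>>0. \<forall>x\<in>{x\<^sub>0..<x\<^sub>0 + \<delta>}. f x = f x\<^sub>0))"

section \<open>Functions on the unit cube\<close>

text \<open>
  Vectors in \<open>real ^ 'm\<close> are ordered componentwise, so \<open>{0..1}\<close> is the unit cube,
  and for \<open>t\<close> in it \<open>{t..1}\<close> consists of the points of the cube that dominate \<open>t\<close>
  in every coordinate.
\<close>

definition right_continuous :: "(real ^ 'm \<Rightarrow> 'b::topological_space) \<Rightarrow> bool" where
  "right_continuous h \<longleftrightarrow> (\<forall>t\<in>{0..1}. continuous (at t within {t..1}) h)"

definition cdf_vec :: "('m \<Rightarrow> real \<Rightarrow> real) \<Rightarrow> real \<Rightarrow> real ^ 'm" where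
  "cdf_vec G x = (\<chi> i. G i x)"

section \<open>The two constructions\<close>

text \<open>The families \<open>\<mu>, l, \<nu>, m\<close> of limits of integration are indexed by \<open>{1..n}\<close>.\<close>

locale construction_data =
  fixes G :: "'m::finite \<Rightarrow> real \<Rightarrow> real"
    and n :: nat
    and F :: "real \<Rightarrow> real"
    and U \<theta> :: "real ^ 'm \<Rightarrow> real"
    and \<mu> l \<nu> m :: "nat \<Rightarrow> real ^ 'm \<Rightarrow> ereal"
  assumes n_ge_1: "n \<ge> 1"
    and cdf_F: "is_cdf F"
    and U_nonneg: "\<And>t. t \<in> {0..1} \<Longrightarrow> U t \<ge> 0"
    and \<theta>_nonneg: "\<And>t. t \<in> {0..1} \<Longrightarrow> \<theta> t \<ge> 0"
    and right_cont: "right_continuous U" "right_continuous \<theta>"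
      "\<And>j. j \<in> {1..n} \<Longrightarrow> right_continuous (\<mu> j)"
      "\<And>j. j \<in> {1..n} \<Longrightarrow> right_continuous (l j)"
      "\<And>j. j \<in> {1..n} \<Longrightarrow> right_continuous (\<nu> j)"
      "\<And>j. j \<in> {1..n} \<Longrightarrow> right_continuous (m j)"
    and non_decreasing: "mono_on {0..1} U"
      "\<And>j. j \<in> {1..n} \<Longrightarrow> mono_on {0..1} (\<mu> j)"
      "\<And>j. j \<in> {1..n} \<Longrightarrow> mono_on {0..1} (m j)"
    and non_increasing: "antimono_on {0..1} \<theta>"
      "\<And>j. j \<in> {1..n} \<Longrightarrow> antimono_on {0..1} (l j)"
      "\<And>j. j \<in> {1..n} \<Longrightarrow> antimono_on {0..1} (\<nu> j)"
    and continuous_or_compatible: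
      "continuous_on UNIV F \<or>
       (\<forall>j\<in>{1..n}. compatible F (\<lambda>x. l j (cdf_vec G x)) \<and>
                   compatible F (\<lambda>x. \<nu> j (cdf_vec G x)))"
    and no_discontinuity:
      "\<And>j t. j \<in> {1..n} \<Longrightarrow> t \<in> {0, 1} \<Longrightarrow>
         \<not> discontinuity_point F (l j t) \<and> \<not> discontinuity_point F (\<mu> j t) \<and>
         \<not> discontinuity_point F (m j t) \<and> \<not> discontinuity_point F (\<nu> j t)"

locale form_A = construction_data +
  assumes at_0_neq: "U 0 \<noteq> \<theta> 0 \<Longrightarrow>
      (U 0 = 0 \<or> (\<forall>j\<in>{1..n}. \<mu> j 0 = l j 0)) \<and>
      (\<theta> 0 = 0 \<or> (\<forall>j\<in>{1..n}. m j 0 = \<nu> j 0))"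
    and at_0_eq: "U 0 = \<theta> 0 \<Longrightarrow> \<theta> 0 \<noteq> 0 \<Longrightarrow>
      (\<forall>j\<in>{1..n}. \<mu> j 0 = \<nu> j 0 \<and> m j 0 = l j 0)"
    and l_le_\<mu>: "\<And>j. j \<in> {1..n} \<Longrightarrow> l j 0 \<le> \<mu> j 0"
    and m_le_\<nu>: "\<And>j. \<theta> 0 \<noteq> 0 \<Longrightarrow> j \<in> {1..n} \<Longrightarrow> m j 1 \<le> \<nu> j 1"
    and covers: "\<mu> n 1 \<ge> (SUP x\<in>{x. F x < 1}. ereal x)"
      "l 1 1 \<le> (INF x\<in>{x. F x > 0}. ereal x)"
    and U_1: "U 1 = 1"
    and at_1: "\<theta> 1 = 0 \<or> (\<forall>j\<in>{1..n}. \<nu> j 1 = m j 1)"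
    and consecutive: "\<And>j. 1 \<le> j \<Longrightarrow> j < n \<Longrightarrow> \<mu> j 1 = l (j + 1) 1"

locale form_B = construction_data +
  assumes at_1_neq: "U 1 \<noteq> \<theta> 1 \<Longrightarrow>
      (\<theta> 1 = 0 \<or> (\<forall>j\<in>{1..n}. m j 1 = \<nu> j 1)) \<and>
      (U 1 = 0 \<or> (\<forall>j\<in>{1..n}. l j 1 = \<mu> j 1))"
    and at_1_eq: "U 1 = \<theta> 1 \<Longrightarrow> \<theta> 1 \<noteq> 0 \<Longrightarrow>
      (\<forall>j\<in>{1..n}. \<mu> j 1 = \<nu> j 1 \<and> m j 1 = l j 1)"
    and m_le_\<nu>: "\<And>j. j \<in> {1..n} \<Longrightarrow> m j 1 \<le> \<nu> j 1"
    and l_le_\<mu>: "\<And>j. U 1 \<noteq> 0 \<Longrightarrow> j \<in> {1..n} \<Longrightarrow> l j 0 \<le> \<mu> j 0"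
    and covers: "\<nu> n 0 \<ge> (SUP x\<in>{x. F x < 1}. ereal x)"
      "m 1 0 \<le> (INF x\<in>{x. F x > 0}. ereal x)"
    and \<theta>_0: "\<theta> 0 = 1"
    and at_0: "U 0 = 0 \<or> (\<forall>j\<in>{1..n}. l j 0 = \<mu> j 0)"
    and consecutive: "\<And>j. 1 \<le> j \<Longrightarrow> j < n \<Longrightarrow> \<nu> j 0 = m (j + 1) 0"

definition generated_A ::
  "('m::finite \<Rightarrow> real \<Rightarrow> real) \<Rightarrow> nat \<Rightarrow> (real \<Rightarrow> real) \<Rightarrow>
   (real ^ 'm \<Rightarrow> real) \<Rightarrow> (real ^ 'm \<Rightarrow> real) \<Rightarrow>
   (nat \<Rightarrow> real ^ 'm \<Rightarrow> ereal) \<Rightarrow> (nat \<Rightarrow> real ^ 'm \<Rightarrow> ereal) \<Rightarrow>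
   (nat \<Rightarrow> real ^ 'm \<Rightarrow> ereal) \<Rightarrow> (nat \<Rightarrow> real ^ 'm \<Rightarrow> ereal) \<Rightarrow> real \<Rightarrow> real" where
  "generated_A G n F U \<theta> \<mu> l \<nu> m x =
     (let t = cdf_vec G x in
        U t * (\<Sum>j=1..n. cdf_integral F (l j t) (\<mu> j t))
        - \<theta> t * (\<Sum>j=1..n. cdf_integral F (m j t) (\<nu> j t)))"

definition generated_B ::
  "('m::finite \<Rightarrow> real \<Rightarrow> real) \<Rightarrow> nat \<Rightarrow> (real \<Rightarrow> real) \<Rightarrow>
   (real ^ 'm \<Rightarrow> real) \<Rightarrow> (real ^ 'm \<Rightarrow> real) \<Rightarrow>
   (nat \<Rightarrow> real ^ 'm \<Rightarrow> ereal) \<Rightarrow> (nat \<Rightarrow> real ^ 'm \<Rightarrow> ereal) \<Rightarrow>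
   (nat \<Rightarrow> real ^ 'm \<Rightarrow> ereal) \<Rightarrow> (nat \<Rightarrow> real ^ 'm \<Rightarrow> ereal) \<Rightarrow> real \<Rightarrow> real" where
  "generated_B G n F U \<theta> \<mu> l \<nu> m x =
     (let t = cdf_vec G x in
        1 - \<theta> t * (\<Sum>j=1..n. cdf_integral F (m j t) (\<nu> j t))
        + U t * (\<Sum>j=1..n. cdf_integral F (l j t) (\<mu> j t)))"

end

theory Submission
  imports Defs
begin

text \<open>
  A cdf is discrete if and only if it takes only countably many values: a cdf is injective on its
  support, and each of its positive values is attained in the support, namely at the corresponding
  quantile. Since \<open>U\<close> and \<open>\<theta>\<close> are \<open>1\<close> along the curve \<open>cdf_vec G\<close>, both constructions are finite
  sums and differences of values of the integrating cdf, so countability of the range is inherited.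
\<close>

text \<open>For \<open>x < y\<close>, the support condition at \<open>y\<close> with \<epsilon>
  equal to \<open>y - x\<close> already separates the two values.\<close>

lemma inj_on_cdf_support: "inj_on F (cdf_support F)"
proof (rule linorder_inj_onI')
  fix x y assume "y \<in> cdf_support F" "x < y"
  then have "F y - F (y - (y - x)) > 0"
    unfolding cdf_support_def by (metis (mono_tags, lifting) diff_gt_0_iff_gt mem_Collect_eq)
  then show "F x \<noteq> F y" by simp
qed

text \<open>The witness is the infimum \<open>q\<close> of the points where \<open>F\<close> is at
  least \<open>F t\<close>: right continuity makes \<open>F\<close> reach that level at
  \<open>q\<close>, and minimality of \<open>q\<close> keeps \<open>F\<close> strictly below it to
  the left.\<close>

lemma cdf_value_attained_in_support:
  assumes F: "is_cdf F" and pos: "F t > 0"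
  shows "F t \<in> F ` cdf_support F"
proof -
  have mono: "mono F" and rc: "\<And>x. continuous (at_right x) F" and lim: "(F \<longlongrightarrow> 0) at_bot"
    using F by (auto simp: is_cdf_def)
  define S where "S = {s. F t \<le> F s}"
  \<comment> \<open>Positivity of \<open>F t\<close> enters here: far to the left \<open>F\<close>
    drops below that level, so \<open>S\<close> is bounded below and \<open>q\<close> is a genuine
    infimum.\<close>
  have "eventually (\<lambda>s. F s < F t) at_bot"
    using order_tendstoD(2)[OF lim pos] .
  then obtain b where b: "\<And>s. s \<le> b \<Longrightarrow> F s < F t"
    by (auto simp: eventually_at_bot_linorder)
  have bdd: "bdd_below S"
    using b unfolding S_def by (intro bdd_belowI[of _ b]) (metis mem_Collect_eq nle_le not_less)
  have tS: "t \<in> S" by (simp add: S_def)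
  define q where "q = Inf S"
  have "q \<le> t" unfolding q_def using tS bdd by (rule cInf_lower)
  have above: "F t \<le> F s" if "q < s" for s
  proof -
    obtain r where "r \<in> S" "r < s"
      using \<open>q < s\<close> tS bdd unfolding q_def by (metis cInf_less_iff empty_iff)
    then show ?thesis using monoD[OF mono, of r s] by (simp add: S_def)
  qed
  \<comment> \<open>Right continuity carries the bound \<open>above\<close> from the points to the
    right of \<open>q\<close> to \<open>q\<close> itself.\<close>
  have "F t \<le> F q"
  proof (rule tendsto_lowerbound)
    show "(F \<longlongrightarrow> F q) (at_right q)" using rc[of q] by (simp add: continuous_within)
    show "eventually (\<lambda>s. F t \<le> F s) (at_right q)"
      using above by (auto intro!: eventually_at_rightI[of q "q + 1"])
  qed simp
  with monoD[OF mono \<open>q \<le> t\<close>] have eq: "F q = F t" by simp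
  have "F (q - e) < F q" if "e > 0" for e
  proof (rule ccontr)
    assume "\<not> F (q - e) < F q"
    then have "q - e \<in> S" using eq by (simp add: S_def)
    then have "q \<le> q - e" unfolding q_def using bdd by (rule cInf_lower)
    with that show False by simp
  qed
  then have "q \<in> cdf_support F" by (simp add: cdf_support_def)
  with eq show ?thesis by (metis image_eqI)
qed

lemma cdf_nonneg:
  assumes "is_cdf F"
  shows "F x \<ge> 0"
proof (rule tendsto_upperbound)
  show "(F \<longlongrightarrow> 0) at_bot" using assms by (simp add: is_cdf_def)
  show "eventually (\<lambda>s. F s \<le> F x) at_bot"
    using assms by (auto simp: is_cdf_def eventually_at_bot_linorder intro: monoD)
qed simp

lemma discrete_cdf_iff_countable_range:
  assumes "is_cdf F"
  shows "discrete_cdf F \<longleftrightarrow> countable (range F)"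
proof
  assume "discrete_cdf F"
  \<comment> \<open>A zero of \<open>F\<close> never lies in the support, so the value
    \<open>0\<close> has to be added separately.\<close>
  then have "countable (insert 0 (F ` cdf_support F))"
    by (simp add: discrete_cdf_def)
  moreover have "range F \<subseteq> insert 0 (F ` cdf_support F)"
    using cdf_value_attained_in_support[OF assms] cdf_nonneg[OF assms]
    by (force simp: less_le)
  ultimately show "countable (range F)" by (rule countable_subset[rotated])
next
  assume "countable (range F)"
  then have "countable (F ` cdf_support F)" by (rule countable_subset[rotated]) auto
  then show "discrete_cdf F"
    using assms countable_image_inj_on[OF _ inj_on_cdf_support] by (simp add: discrete_cdf_def)
qed

lemma countable_range_cdf_ext:
  assumes "countable (range F)"
  shows "countable (range (cdf_ext F))"
proof (rule countable_subset)
  show "range (cdf_ext F) \<subseteq> {0, 1} \<union> range F"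
    by (auto simp: cdf_ext_def split: ereal.splits)
qed (use assms in simp)

text \<open>Keeping \<open>h\<close> arbitrary covers sums, differences and the combination
  \<open>1 - a + b\<close> of Form B at once.\<close>

lemma countable_range_binop:
  assumes "countable (range f)" "countable (range g)"
  shows "countable (range (\<lambda>x. h (f x) (g x)))"
proof (rule countable_subset)
  show "range (\<lambda>x. h (f x) (g x)) \<subseteq> (\<lambda>(a, b). h a b) ` (range f \<times> range g)" by auto
qed (use assms in simp)

lemma countable_range_sum:
  fixes f :: "'i \<Rightarrow> 'a \<Rightarrow> 'b::comm_monoid_add"
  assumes "\<And>i. i \<in> I \<Longrightarrow> countable (range (f i))"
  shows "countable (range (\<lambda>x. \<Sum>i\<in>I. f i x))"
  using assms
proof (induction I rule: infinite_finite_induct)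
  case (insert i I)
  then show ?case by (simp add: countable_range_binop[where h = "(+)"])
\<comment> \<open>For infinite or empty \<open>I\<close> the sum is \<open>0\<close>
  everywhere.\<close>
qed (auto intro: countable_subset[of _ "{0}"])

text \<open>Wherever its limits lie, each integral is a difference of two values of
  \<open>cdf_ext F\<close>, which come from a fixed countable set; hence \<open>a\<close> and
  \<open>b\<close> can be arbitrary.\<close>

lemma countable_range_sum_cdf_integral:
  fixes n :: nat
  assumes "countable (range F)"
  shows "countable (range (\<lambda>x. \<Sum>j=1..n. cdf_integral F (a j x) (b j x)))"
proof (rule countable_range_sum)
  fix j
  have "countable (range (\<lambda>x. cdf_ext F (c x)))" for c :: "'a \<Rightarrow> ereal"
    by (rule countable_subset[OF _ countable_range_cdf_ext[OF assms]]) auto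
  then show "countable (range (\<lambda>x. cdf_integral F (a j x) (b j x)))"
    unfolding cdf_integral_def by (intro countable_range_binop[where h = "(-)"])
qed

theorem theorem7:
  fixes G :: "'m::finite \<Rightarrow> real \<Rightarrow> real"
    and F \<phi> :: "real \<Rightarrow> real"
    and n \<eta> :: nat
    and U \<theta> :: "real ^ 'm \<Rightarrow> real"
    and \<mu> l \<nu> m :: "nat \<Rightarrow> real ^ 'm \<Rightarrow> ereal"
  assumes "\<And>i. is_cdf (G i)"
    and "\<And>x. U (cdf_vec G x) = 1"
    and "\<And>x. \<theta> (cdf_vec G x) = 1"
  shows "(form_A G n F U \<theta> \<mu> l \<nu> m \<and> is_cdf (generated_A G n F U \<theta> \<mu> l \<nu> m) \<and>
            discrete_cdf F
          \<longrightarrow> discrete_cdf (generated_A G n F U \<theta> \<mu> l \<nu> m)) \<and>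
         (form_B G \<eta> \<phi> U \<theta> \<mu> l \<nu> m \<and> is_cdf (generated_B G \<eta> \<phi> U \<theta> \<mu> l \<nu> m) \<and>
            discrete_cdf \<phi>
          \<longrightarrow> discrete_cdf (generated_B G \<eta> \<phi> U \<theta> \<mu> l \<nu> m))"
proof (intro conjI impI; elim conjE)
  assume cdf: "is_cdf (generated_A G n F U \<theta> \<mu> l \<nu> m)" and "discrete_cdf F"
  then have "countable (range F)"
    using discrete_cdf_iff_countable_range discrete_cdf_def by blast
  then have "countable (range (generated_A G n F U \<theta> \<mu> l \<nu> m))"
    \<comment> \<open>Both weights become \<open>1\<close>, which leaves a plain difference of two
      sums of integrals.\<close>
    unfolding generated_A_def Let_def assms(2,3) mult_1
    by (intro countable_range_binop[where h = "(-)"] countable_range_sum_cdf_integral)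
  with cdf show "discrete_cdf (generated_A G n F U \<theta> \<mu> l \<nu> m)"
    by (simp add: discrete_cdf_iff_countable_range)
next
  assume cdf: "is_cdf (generated_B G \<eta> \<phi> U \<theta> \<mu> l \<nu> m)" and "discrete_cdf \<phi>"
  then have "countable (range \<phi>)"
    using discrete_cdf_iff_countable_range discrete_cdf_def by blast
  then have "countable (range (generated_B G \<eta> \<phi> U \<theta> \<mu> l \<nu> m))"
    unfolding generated_B_def Let_def assms(2,3) mult_1
    by (intro countable_range_binop[where h = "\<lambda>a b. 1 - a + b"]
        countable_range_sum_cdf_integral)
  with cdf show "discrete_cdf (generated_B G \<eta> \<phi> U \<theta> \<mu> l \<nu> m)"
    by (simp add: discrete_cdf_iff_countable_range)
qed

end
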